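(* Let $\mathbf r=(x,y,z)\in\mathbb R^3$ have spherical coordinates $(r,\theta,\varphi)$, i.e. $\mathbf r=(r\sin\theta\cos\varphi,\ r\sin\theta\sin\varphi,\ r\cos\theta)$, let $\alpha\in[0,2\pi)$, and let $\mathbf k_0=(\cos\alpha,\sin\alpha,\mathrm i)\in\mathbb C^3$. Then for all $r>0$ and all $k_\rho>0$, $$e^{\mathrm i k_\rho \mathbf k_0\cdot\mathbf r}=\sum_{n=0}^{\infty}\sum_{m=-n}^{n}C_n^m\, r^n\, Y_n^m(\theta,\varphi)\,k_\rho^n\, e^{-\mathrm i m\alpha}=\sum_{n=0}^{\infty}\sum_{m=-n}^{n}C_n^m\, r^n\,\overline{Y_n^m(\theta,\varphi)}\,k_\rho^n\, e^{\mathrm i m\alpha},$$ where $$C_n^m=\mathrm i^{2n-m}\sqrt{\frac{4\pi}{(2n+1)(n+m)!(n-m)!}}.$$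
   Context: Here $\mathrm i$ is the imaginary unit, and $\mathbf k_0\cdot\mathbf r=x\cos\alpha+y\sin\alpha+\mathrm i z$ is the bilinear dot product (no complex conjugation). Let $P_n$ be the Legendre polynomial of degree $n$. For integers $0\le m\le n$ the associated Legendre function is $P_n^m(x)=(-1)^m(1-x^2)^{m/2}\frac{d^m}{dx^m}P_n(x)$, and for $0<m\le n$, $P_n^{-m}(x)=(-1)^m\frac{(n-m)!}{(n+m)!}P_n^m(x)$. For $|m|\le n$ the normalized associated Legendre function is $$\widehat P_n^m(x)=(-1)^m\sqrt{\frac{2n+1}{4\pi}\frac{(n-m)!}{(n+m)!}}\,P_n^m(x),$$ so that $\widehat P_n^{-m}(x)=(-1)^m\widehat P_n^m(x)$. The spherical harmonics are $Y_n^m(\theta,\varphi)=\widehat P_n^m(\cos\theta)e^{\mathrm i m\varphi}$. *)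

theory Defs
  imports "HOL-Analysis.Analysis" "HOL-Computational_Algebra.Polynomial"
begin

(* Rodrigues' formula: P_n = 1 / (2^n n!) * d^n/dx^n (x^2 - 1)^n. *)
definition legendre_poly :: "nat \<Rightarrow> real poly" where
  "legendre_poly n = smult (1 / (2 ^ n * fact n)) ((pderiv ^^ n) ([:-1, 0, 1:] ^ n))"

(* sqrt (1 - x^2) ^ m stands for (1 - x^2)^(m/2); "powr" would give the wrong value 0
   at x = 1, -1 for m = 0. *)
definition assoc_legendre_nat :: "nat \<Rightarrow> nat \<Rightarrow> real \<Rightarrow> real" where
  "assoc_legendre_nat n m x =
     (-1) ^ m * sqrt (1 - x\<^sup>2) ^ m * poly ((pderiv ^^ m) (legendre_poly n)) x"

(* Meaningful for \<bar>m\<bar> \<le> n only, as are all the functions of an integer order m below. *)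
definition assoc_legendre :: "nat \<Rightarrow> int \<Rightarrow> real \<Rightarrow> real" where
  "assoc_legendre n m x =
     (if 0 \<le> m then assoc_legendre_nat n (nat m) x
      else (-1) ^ nat (- m) * (fact (n - nat (- m)) / fact (n + nat (- m)))
             * assoc_legendre_nat n (nat (- m)) x)"

definition normalized_legendre :: "nat \<Rightarrow> int \<Rightarrow> real \<Rightarrow> real" where
  "normalized_legendre n m x =
     (-1) powi m
     * sqrt ((2 * real n + 1) / (4 * pi) * (fact (nat (int n - m)) / fact (nat (int n + m))))
     * assoc_legendre n m x"

definition spherical_harmonic :: "nat \<Rightarrow> int \<Rightarrow> real \<Rightarrow> real \<Rightarrow> complex" where
  "spherical_harmonic n m \<theta> \<phi> =
     complex_of_real (normalized_legendre n m (cos \<theta>)) * exp (\<i> * of_int m * complex_of_real \<phi>)"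

(* For -n \<le> m \<le> n the exponent 2n - m is nonnegative. *)
definition expansion_coeff :: "nat \<Rightarrow> int \<Rightarrow> complex" where
  "expansion_coeff n m =
     \<i> powi (2 * int n - m)
     * complex_of_real (sqrt (4 * pi /
         ((2 * real n + 1) * fact (nat (int n + m)) * fact (nat (int n - m)))))"

definition wave_vector :: "real \<Rightarrow> complex ^ 3" where
  "wave_vector \<alpha> = vector [complex_of_real (cos \<alpha>), complex_of_real (sin \<alpha>), \<i>]"

(* Bilinear, i.e. without conjugation, unlike a Hermitian inner product. *)
definition bilinear_dot :: "complex ^ 3 \<Rightarrow> real ^ 3 \<Rightarrow> complex" where
  "bilinear_dot k v = (\<Sum>j\<in>UNIV. k $ j * complex_of_real (v $ j))"

end

theory Submission
  imports Defs
begin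

text \<open>
  Taylor's formula for \<open>(x\<^sup>2 - 1)\<^sup>n\<close> at \<open>c = cos \<theta>\<close> and Rodrigues' formula identify the coefficients
  of \<open>(h\<^sup>2 + 2ch - s\<^sup>2)\<^sup>n\<close>, \<open>s = sin \<theta>\<close>, with the derivatives of \<open>P\<^sub>n\<close> at \<open>c\<close>. For \<open>h = sw\<close> this trinomial
  is \<open>h\<^sup>n (sw + 2c - s/w)\<^sup>n\<close>, and at \<open>w = -\<i> exp (\<i>\<psi>)\<close>, \<open>\<psi> = \<plusminus>(\<phi> - \<alpha>)\<close>, the second factor is
  \<open>2\<^sup>n (c - \<i> s cos \<psi>)\<^sup>n\<close>. So the degree \<open>n\<close> part of the series is the \<open>n\<close>-th term of the
  exponential series. The negative orders are handled by the symmetry \<open>w \<mapsto> -1/w\<close>.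
\<close>

lemma map_poly_of_real_mult:
  "map_poly of_real (p * q) =
    (map_poly of_real p * map_poly of_real q :: 'a :: {real_algebra_1, comm_semiring_1} poly)"
  by (simp add: poly_eq_iff coeff_map_poly coeff_mult)

lemma map_poly_of_real_power:
  "map_poly of_real (p ^ n) =
    (map_poly of_real p ^ n :: 'a :: {real_algebra_1, comm_semiring_1} poly)"
  by (induction n) (simp_all add: map_poly_of_real_mult)

lemma higher_pderiv_pcompose_shift:
  fixes p :: "'a :: idom poly"
  shows "(pderiv ^^ k) (pcompose p [:c, 1:]) = pcompose ((pderiv ^^ k) p) [:c, 1:]"
  by (induction k) (simp_all add: pderiv_pcompose pderiv_pCons)

lemma pcompose_power: "pcompose (p ^ n) q = pcompose p q ^ n"
  by (induction n) (simp_all add: pcompose_1 pcompose_mult)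

text \<open>Taylor's formula: differentiation commutes with the shift by \<open>c\<close>, and the
  constant coefficient of the \<open>k\<close>-th derivative is \<open>fact k\<close> times the
  \<open>k\<close>-th coefficient.\<close>

lemma coeff_pcompose_shift:
  fixes p :: "'a :: field_char_0 poly"
  shows "coeff (pcompose p [:c, 1:]) k = poly ((pderiv ^^ k) p) c / fact k"
proof -
  have "fact k * coeff (pcompose p [:c, 1:]) k = coeff ((pderiv ^^ k) (pcompose p [:c, 1:])) 0"
    by (simp add: coeff_higher_pderiv pochhammer_fact)
  also have "\<dots> = poly ((pderiv ^^ k) p) c"
    by (simp add: higher_pderiv_pcompose_shift poly_pcompose flip: poly_0_coeff_0)
  finally show ?thesis
    by (simp add: field_simps)
qed

text \<open>The trinomial is (c + h)^2 - 1 as a polynomial in h. Of the \<open>n + m\<close>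
  derivatives in its Taylor coefficient, \<open>n\<close> yield \<open>legendre_poly n\<close> by
  Rodrigues' formula and \<open>m\<close> remain.\<close>

lemma coeff_trinomial_legendre:
  "coeff ([:c\<^sup>2 - 1, 2 * c, 1:] ^ n) (n + m) =
     2 ^ n * fact n / fact (n + m) * poly ((pderiv ^^ m) (legendre_poly n)) c"
proof -
  have "[:c\<^sup>2 - 1, 2 * c, 1:] = pcompose [:-1, 0, 1:] [:c, 1:]"
    by (simp add: pcompose_pCons power2_eq_square)
  then have "coeff ([:c\<^sup>2 - 1, 2 * c, 1:] ^ n) (n + m) =
      poly ((pderiv ^^ (n + m)) ([:-1, 0, 1:] ^ n)) c / fact (n + m)"
    by (simp only: coeff_pcompose_shift flip: pcompose_power)
  then show ?thesis
    by (simp add: legendre_poly_def higher_pderiv_smult add.commute[of n m] funpow_add)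
qed

text \<open>Substituting h = s w takes a factor s out of the trinomial; comparing coefficients of
  w^(n+m) leaves s^(n+m) against s^n, which can be cancelled only for nonzero s.\<close>

lemma coeff_trinomial_scaled:
  fixes s c :: real
  assumes "s\<^sup>2 + c\<^sup>2 = 1"
  shows "coeff ([:- s, 2 * c, s:] ^ n) (n + m) = s ^ m * coeff ([:c\<^sup>2 - 1, 2 * c, 1:] ^ n) (n + m)"
proof (cases "s = 0")
  case True
  \<comment> \<open>Here c^2 = 1, so both trinomials lose their constant term. For
    \<open>m = 0\<close> both coefficients are (2c)^n, otherwise both sides vanish.\<close>
  have "[:0, 2 * c, 0:] = monom (2 * c) 1" and eq: "[:0, 2 * c, 1:] = monom 1 1 * [:2 * c, 1:]"
    by (simp_all add: monom_altdef)
  moreover have "coeff ([:0, 2 * c, 1:] ^ n) n = (2 * c) ^ n"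
    by (simp only: eq power_mult_distrib monom_power) (simp add: coeff_monom_mult coeff_0_power)
  ultimately show ?thesis
    using True assms by (cases "m = 0") (auto simp: monom_power)
next
  case False
  have c: "c\<^sup>2 - 1 = - s * s"
    using assms by (simp add: power2_eq_square)
  have "pcompose [:c\<^sup>2 - 1, 2 * c, 1:] [:0, s:] = smult s [:- s, 2 * c, s:]"
    by (simp add: pcompose_pCons c)
  then have "pcompose ([:c\<^sup>2 - 1, 2 * c, 1:] ^ n) [:0, s:] = smult (s ^ n) ([:- s, 2 * c, s:] ^ n)"
    by (simp only: pcompose_power smult_power)
  then have "s ^ (n + m) * coeff ([:c\<^sup>2 - 1, 2 * c, 1:] ^ n) (n + m) =
      s ^ n * coeff ([:- s, 2 * c, s:] ^ n) (n + m)"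
    by (metis coeff_pcompose_linear coeff_smult)
  with False show ?thesis
    by (simp add: power_add)
qed

text \<open>Replacing w by -w in the quadratic gives minus its reflection, and reflecting the
  \<open>n\<close>-th power swaps the coefficients at \<open>n - m\<close> and
  \<open>n + m\<close>.\<close>

lemma coeff_trinomial_antisym:
  fixes s c :: real
  assumes "m \<le> n"
  shows "coeff ([:- s, 2 * c, s:] ^ n) (n - m) = (-1) ^ m * coeff ([:- s, 2 * c, s:] ^ n) (n + m)"
proof (cases "s = 0")
  case True
  have "[:0, 2 * c, 0:] = monom (2 * c) 1"
    by (simp add: monom_altdef)
  with True assms show ?thesis
    by (cases "m = 0") (auto simp: monom_power)
next
  case False
  let ?q = "[:- s, 2 * c, s:]"
  have "pcompose ?q [:0, -1:] = smult (-1) (reflect_poly ?q)"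
    using False by (simp add: pcompose_pCons reflect_poly_pCons)
  then have "pcompose (?q ^ n) [:0, -1:] = smult ((-1) ^ n) (reflect_poly (?q ^ n))"
    by (simp only: pcompose_power smult_power reflect_poly_power)
  then have "(-1) ^ (n - m) * coeff (?q ^ n) (n - m) = (-1) ^ n * coeff (reflect_poly (?q ^ n)) (n - m)"
    by (metis coeff_pcompose_linear coeff_smult)
  \<comment> \<open>\<open>reflect_poly\<close> reverses about the actual degree, hence the separate
    case s = 0.\<close>
  moreover have "degree (?q ^ n) = 2 * n"
    using False by (simp add: degree_power_eq)
  ultimately have "(-1) ^ (n - m) * coeff (?q ^ n) (n - m) = (-1) ^ n * coeff (?q ^ n) (n + m)"
    using assms by (simp add: coeff_reflect_poly)
  moreover have "(-1 :: real) ^ n = (-1) ^ (n - m) * (-1) ^ m"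
    using assms by (simp flip: power_add)
  ultimately show ?thesis
    by simp
qed

lemma sum_coeff_trinomial:
  fixes w :: complex
  assumes "w \<noteq> 0"
  shows "(\<Sum>m = - int n..int n. of_real (coeff ([:- s, 2 * c, s:] ^ n) (nat (int n + m))) * w powi m) =
    (of_real s * w + 2 * of_real c - of_real s / w) ^ n"
proof -
  let ?q = "[:- s, 2 * c, s:]"
  define Q where "Q = map_poly complex_of_real (?q ^ n)"
  have Q: "Q = [:- of_real s, 2 * of_real c, of_real s:] ^ n"
    by (simp add: Q_def map_poly_of_real_power map_poly_pCons)
  have "degree Q \<le> 2 * n"
    using degree_power_le[of "[:- of_real s, 2 * of_real c, of_real s:] :: complex poly" n]
    by (auto simp: Q split: if_splits)
  have "(\<Sum>m = - int n..int n. of_real (coeff (?q ^ n) (nat (int n + m))) * w powi m) =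
      (\<Sum>k\<le>2 * n. coeff Q k * w powi (int k - int n))"
    by (rule sum.reindex_bij_witness[of _ "\<lambda>k. int k - int n" "\<lambda>m. nat (int n + m)"])
       (auto simp: Q_def coeff_map_poly)
  also have "\<dots> = (\<Sum>k\<le>2 * n. coeff Q k * w ^ k) / w ^ n"
    using assms by (simp add: power_int_diff sum_divide_distrib)
  \<comment> \<open>The degree drops below \<open>2 * n\<close> when s = 0 and n > 0; the extra
    coefficients are 0.\<close>
  also have "(\<Sum>k\<le>2 * n. coeff Q k * w ^ k) = poly Q w"
    unfolding poly_altdef using \<open>degree Q \<le> 2 * n\<close>
    by (intro sum.mono_neutral_right) (auto simp: coeff_eq_0)
  also have "poly Q w / w ^ n = (of_real s * w + 2 * of_real c - of_real s / w) ^ n"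
    using assms by (simp add: Q poly_power flip: power_divide) (simp add: field_simps)
  finally show ?thesis .
qed

text \<open>Under the product of the two square roots everything cancels except the square of
  1/(n+m)!.\<close>

lemma expansion_coeff_normalized_legendre:
  "expansion_coeff n m * of_real (normalized_legendre n m x) =
    \<i> powi (2 * int n - m) * of_real ((-1) powi m * assoc_legendre n m x / fact (nat (int n + m)))"
proof -
  define A B :: real where "A = fact (nat (int n + m))" and "B = fact (nat (int n - m))"
  have pos: "A > 0" "B > 0"
    by (simp_all add: A_def B_def)
  have "sqrt (4 * pi / ((2 * real n + 1) * A * B)) * sqrt ((2 * real n + 1) / (4 * pi) * (B / A)) =
      sqrt ((1 / A)\<^sup>2)"
    using pos unfolding real_sqrt_mult[symmetric]
    by (intro arg_cong[where f = sqrt]) (auto simp: divide_simps power2_eq_square)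
  also have "\<dots> = 1 / A"
    using pos by simp
  finally have *: "sqrt (4 * pi / ((2 * real n + 1) * A * B)) *
      sqrt ((2 * real n + 1) / (4 * pi) * (B / A)) = 1 / A" .
  have "sqrt (4 * pi / ((2 * real n + 1) * A * B)) * normalized_legendre n m x =
      (sqrt (4 * pi / ((2 * real n + 1) * A * B)) * sqrt ((2 * real n + 1) / (4 * pi) * (B / A))) *
      ((-1) powi m * assoc_legendre n m x)"
    unfolding normalized_legendre_def A_def B_def by (simp only: mult_ac)
  also have "\<dots> = (-1) powi m * assoc_legendre n m x / A"
    unfolding * by simp
  finally show ?thesis
    unfolding expansion_coeff_def A_def B_def by (simp only: mult.assoc flip: of_real_mult)
qed

lemma expansion_coeff_trinomial:
  assumes "\<bar>m\<bar> \<le> int n" and "0 \<le> \<theta>" and "\<theta> \<le> pi"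
  shows "expansion_coeff n m * of_real (normalized_legendre n m (cos \<theta>)) =
    (-1) ^ n / (2 ^ n * fact n) * (- \<i>) powi m *
    of_real (coeff ([:- sin \<theta>, 2 * cos \<theta>, sin \<theta>:] ^ n) (nat (int n + m)))"
proof -
  define k where "k = nat \<bar>m\<bar>"
  define D where "D = sin \<theta> ^ k * poly ((pderiv ^^ k) (legendre_poly n)) (cos \<theta>)"
  let ?b = "coeff ([:- sin \<theta>, 2 * cos \<theta>, sin \<theta>:] ^ n)"
  have k: "k \<le> n"
    using assms by (simp add: k_def)
  have b: "?b (n + k) = 2 ^ n * fact n / fact (n + k) * D"
    unfolding D_def by (subst coeff_trinomial_scaled) (simp_all add: coeff_trinomial_legendre)
  \<comment> \<open>The range of \<theta> rules out the sign change in the absolute value of the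
    sine.\<close>
  have "sqrt (1 - (cos \<theta>)\<^sup>2) = sin \<theta>"
    using assms sin_ge_zero by (simp flip: sin_squared_eq)
  then have assoc: "assoc_legendre_nat n k (cos \<theta>) = (-1) ^ k * D"
    by (simp add: assoc_legendre_nat_def D_def)
  have i: "\<i> powi (2 * int n - m) = (-1) ^ n * (- \<i>) powi m"
  proof -
    have "\<i> powi (2 * int n - m) = \<i> powi (2 * int n) * (inverse \<i>) powi m"
      unfolding power_int_inverse by (simp add: power_int_diff divide_inverse)
    also have "\<i> powi (2 * int n) = (-1) ^ n"
      by (simp add: power_int_mult)
    finally show ?thesis by simp
  qed
  have "(-1) powi m * assoc_legendre n m (cos \<theta>) / fact (nat (int n + m)) =
      1 / (2 ^ n * fact n) * ?b (nat (int n + m))"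
  proof (cases "0 \<le> m")
    case True
    then have m: "m = int k"
      by (simp add: k_def)
    show ?thesis
      by (simp add: m assoc_legendre_def assoc b nat_int_add flip: power_mult_distrib mult.assoc)
  next
    case False
    then have m: "m = - int k" "0 < k"
      by (simp_all add: k_def)
    \<comment> \<open>The factor (n-k)!/(n+k)! in \<open>assoc_legendre\<close> turns the division
      by (n-k)! into one by (n+k)!, as in \<open>b\<close>; the remaining sign (-1)^k is that of the
      antisymmetry.\<close>
    have "nat (int n - int k) = n - k"
      by simp
    with m show ?thesis
      using coeff_trinomial_antisym[OF k, of "sin \<theta>" "cos \<theta>"]
      by (simp add: assoc_legendre_def assoc b power_int_minus flip: power_mult_distrib mult.assoc)
  qed
  then show ?thesis
    unfolding expansion_coeff_normalized_legendre i by simp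
qed

lemma sum_expansion_coeff_trinomial:
  assumes "0 \<le> \<theta>" and "\<theta> \<le> pi"
  shows "(\<Sum>m = - int n..int n. expansion_coeff n m * of_real (normalized_legendre n m (cos \<theta>)) *
      exp (\<i> * of_int m * of_real \<psi>)) =
    (\<i> * of_real (sin \<theta> * cos \<psi>) - of_real (cos \<theta>)) ^ n / fact n"
proof -
  let ?u = "exp (\<i> * complex_of_real \<psi>)"
  let ?w = "- \<i> * ?u"
  let ?s = "complex_of_real (sin \<theta>)" and ?c = "complex_of_real (cos \<theta>)"
  let ?b = "\<lambda>m. complex_of_real (coeff ([:- sin \<theta>, 2 * cos \<theta>, sin \<theta>:] ^ n) (nat (int n + m)))"
  have exp_w: "(- \<i>) powi m * exp (\<i> * of_int m * of_real \<psi>) = ?w powi m" for m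
    unfolding power_int_mult_distrib exp_power_int by (simp add: mult_ac)
  have "(\<Sum>m = - int n..int n. expansion_coeff n m * of_real (normalized_legendre n m (cos \<theta>)) *
      exp (\<i> * of_int m * of_real \<psi>)) =
      (\<Sum>m = - int n..int n. (-1) ^ n / (2 ^ n * fact n) * (?b m * ?w powi m))"
    unfolding exp_w[symmetric] using assms
    by (intro sum.cong refl) (simp add: expansion_coeff_trinomial abs_le_iff)
  also have "\<dots> = (-1) ^ n / (2 ^ n * fact n) * (?s * ?w + 2 * ?c - ?s / ?w) ^ n"
    unfolding sum_distrib_left[symmetric] by (subst sum_coeff_trinomial) simp_all
  \<comment> \<open>With w = -\<i> u one has -1/w = -\<i>/u, so w - 1/w = -\<i> (u + 1/u), a
    multiple of the cosine.\<close>
  also have "?s * ?w + 2 * ?c - ?s / ?w = 2 * (?c - \<i> * ?s * ((?u + inverse ?u) / 2))"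
    by (simp add: field_simps)
  also have "(?u + inverse ?u) / 2 = of_real (cos \<psi>)"
    by (simp add: cos_exp_eq exp_minus flip: cos_of_real)
  also have "(-1) ^ n / (2 ^ n * fact n) * (2 * (?c - \<i> * ?s * of_real (cos \<psi>))) ^ n =
      ((-1) * (?c - \<i> * ?s * of_real (cos \<psi>))) ^ n / fact n"
    unfolding power_mult_distrib by simp
  also have "(-1) * (?c - \<i> * ?s * of_real (cos \<psi>)) = \<i> * of_real (sin \<theta> * cos \<psi>) - ?c"
    by simp
  finally show ?thesis .
qed

lemma sums_expansion_legendre:
  assumes "0 \<le> \<theta>" and "\<theta> \<le> pi"
  shows "(\<lambda>n. \<Sum>m = - int n..int n. expansion_coeff n m * of_real (normalized_legendre n m (cos \<theta>)) *
      exp (\<i> * of_int m * of_real \<psi>) * z ^ n)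
    sums exp (z * (\<i> * of_real (sin \<theta> * cos \<psi>) - of_real (cos \<theta>)))"
  using exp_converges[of "z * (\<i> * of_real (sin \<theta> * cos \<psi>) - of_real (cos \<theta>))"]
  unfolding sum_distrib_right[symmetric] sum_expansion_coeff_trinomial[OF assms] power_mult_distrib
  by (simp add: scaleR_conv_of_real divide_inverse mult_ac)

theorem proposition2p2:
  fixes rvec :: "real ^ 3" and r \<theta> \<phi> \<alpha> k\<^sub>\<rho> :: real
  assumes "r > 0"
    and "0 \<le> \<theta>" and "\<theta> \<le> pi"
    and "rvec = vector [r * sin \<theta> * cos \<phi>, r * sin \<theta> * sin \<phi>, r * cos \<theta>]"
    and "0 \<le> \<alpha>" and "\<alpha> < 2 * pi"
    and "k\<^sub>\<rho> > 0"
  shows "(\<lambda>n. \<Sum>m = - int n..int n.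
            expansion_coeff n m * complex_of_real r ^ n * spherical_harmonic n m \<theta> \<phi>
            * complex_of_real k\<^sub>\<rho> ^ n * exp (- \<i> * of_int m * complex_of_real \<alpha>))
         sums exp (\<i> * complex_of_real k\<^sub>\<rho> * bilinear_dot (wave_vector \<alpha>) rvec)
       \<and> (\<lambda>n. \<Sum>m = - int n..int n.
            expansion_coeff n m * complex_of_real r ^ n * cnj (spherical_harmonic n m \<theta> \<phi>)
            * complex_of_real k\<^sub>\<rho> ^ n * exp (\<i> * of_int m * complex_of_real \<alpha>))
         sums exp (\<i> * complex_of_real k\<^sub>\<rho> * bilinear_dot (wave_vector \<alpha>) rvec)"
proof -
  let ?z = "complex_of_real r * complex_of_real k\<^sub>\<rho>"
  \<comment> \<open>The dot product is r (sin \<theta> cos (\<phi> - \<alpha>) + \<i> cos \<theta>);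
    multiplication by \<i> makes the second term real and negates the cosine.\<close>
  have limit: "\<i> * complex_of_real k\<^sub>\<rho> * bilinear_dot (wave_vector \<alpha>) rvec =
      ?z * (\<i> * of_real (sin \<theta> * cos (\<phi> - \<alpha>)) - of_real (cos \<theta>))"
    by (simp add: assms(4) bilinear_dot_def wave_vector_def sum_3 cos_diff algebra_simps)
  have phase: "exp (\<i> * of_int m * complex_of_real (x - y)) =
      exp (\<i> * of_int m * complex_of_real x) * exp (- \<i> * of_int m * complex_of_real y)" for m x y
    by (simp add: algebra_simps flip: exp_add)
  have cnj: "cnj (exp (\<i> * of_int m * complex_of_real x)) = exp (- \<i> * of_int m * complex_of_real x)"
    for m x
    by (simp add: exp_cnj)
  show ?thesis
    unfolding limit spherical_harmonic_def complex_cnj_mult complex_cnj_complex_of_real cnj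
    \<comment> \<open>Conjugation only reverses the sign of \<phi> in the phase, so the second
      series has the angle \<alpha> - \<phi>; the limits agree because cosine is even.\<close>
    using sums_expansion_legendre[OF assms(2,3), of "\<phi> - \<alpha>" ?z]
      sums_expansion_legendre[OF assms(2,3), of "\<alpha> - \<phi>" ?z]
    unfolding phase power_mult_distrib cos_diff
    by (simp only: mult_ac)
qed

end
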